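(* Let $q$ be a prime power. There exist the following families of mutually orthogonal $(q^3,3,2,1)$ Sudoku hypercubes (all members of a family using the same fixed block partition): (a) a family of size $q^2(q^2-1)(q^2-q)$ with block size $(q^2,q^2,q^2)$; (b) a family of size $q^2(q-1)(q^3-1)$ with block size $(q^3,q^2,q)$; (c) a family of size $(q^3-1)^2$ with block size $(q^3,q^3,1)$. The family sizes in (b) and (c) are best possible, i.e. no family of mutually orthogonal $(q^3,3,2,1)$ Sudoku hypercubes with a common fixed block partition of the respective block size is larger.
   Context: Let $n=q^3$ and $[n]=\{1,\dots,n\}$ (any set of size $n$ may be used to index each coordinate). An $(n,3,2,1)$ Latin hypercube is a function $L:[n]^3\to S$ with $|S|=n^2$ such that every hyperplane (the set of cells obtained by fixing one of the three coordinates) contains each symbol of $S$ exactly once. Block partition of block size $(b_1,b_2,b_3)$, where each $b_i$ divides $n$ and $b_1b_2b_3=n^2$: for each $i\in\{1,2,3\}$, the $i$th coordinate set is partitioned into $n/b_i$ groups of size $b_i$; the blocks are the Cartesian products of three groups, one from each coordinate. An $(n,3,2,1)$ Sudoku hypercube of block size $(b_1,b_2,b_3)$ with respect to such a partition is an $(n,3,2,1)$ Latin hypercube in which every block contains each symbol exactly once. Two hypercubes $L:[n]^3\to S$ and $M:[n]^3\to T$ are orthogonal if no ordered pair $(s,t)\in S\times T$ occurs in more than one cell when $L$ and $M$ are superimposed, i.e. $x\mapsto(L(x),M(x))$ is injective on $[n]^3$. A family is mutually orthogonal if any two distinct members are orthogonal. *)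

theory Defs
  imports "HOL-Library.FuncSet" "HOL-Library.Disjoint_Sets" "HOL-Number_Theory.Prime_Powers"
begin

type_synonym cell = "nat \<times> nat \<times> nat"

definition cells :: "nat \<Rightarrow> cell set" where
  "cells n = {1..n} \<times> {1..n} \<times> {1..n}"

definition hyperplanes :: "nat \<Rightarrow> cell set set" where
  "hyperplanes n =
     {{c} \<times> {1..n} \<times> {1..n} | c. c \<in> {1..n}} \<union>
     {{1..n} \<times> {c} \<times> {1..n} | c. c \<in> {1..n}} \<union>
     {{1..n} \<times> {1..n} \<times> {c} | c. c \<in> {1..n}}"

definition each_symbol_once :: "(cell \<Rightarrow> 's) \<Rightarrow> 's set \<Rightarrow> cell set \<Rightarrow> bool" where
  "each_symbol_once L S A \<longleftrightarrow> (\<forall>s\<in>S. \<exists>!x. x \<in> A \<and> L x = s)"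

text \<open>The parameters \<open>(n,3,2,1)\<close>: side length \<open>n\<close>, dimension 3, an alphabet of size \<open>n\<^sup>2\<close>,
  and each symbol exactly once wherever one coordinate is fixed.\<close>

definition latin_hypercube :: "nat \<Rightarrow> 's set \<Rightarrow> (cell \<Rightarrow> 's) \<Rightarrow> bool" where
  "latin_hypercube n S L \<longleftrightarrow>
     finite S \<and> card S = n ^ 2 \<and> L \<in> cells n \<rightarrow> S \<and>
     (\<forall>H\<in>hyperplanes n. each_symbol_once L S H)"

text \<open>A block partition is given by one partition of \<open>{1..n}\<close> for each coordinate. That the
  \<open>i\<close>th of them has \<open>n div b\<^sub>i\<close> groups follows from all its groups having size \<open>b\<^sub>i\<close>.\<close>

type_synonym coord_partitions = "nat set set \<times> nat set set \<times> nat set set"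

definition groups_of_size :: "nat \<Rightarrow> nat \<Rightarrow> nat set set \<Rightarrow> bool" where
  "groups_of_size n b P \<longleftrightarrow> partition_on {1..n} P \<and> (\<forall>G\<in>P. card G = b)"

fun block_partition :: "nat \<Rightarrow> nat \<times> nat \<times> nat \<Rightarrow> coord_partitions \<Rightarrow> bool" where
  "block_partition n (b1, b2, b3) (P1, P2, P3) \<longleftrightarrow>
     b1 dvd n \<and> b2 dvd n \<and> b3 dvd n \<and> b1 * b2 * b3 = n ^ 2 \<and>
     groups_of_size n b1 P1 \<and> groups_of_size n b2 P2 \<and> groups_of_size n b3 P3"

fun blocks :: "coord_partitions \<Rightarrow> cell set set" where
  "blocks (P1, P2, P3) = {G1 \<times> G2 \<times> G3 | G1 G2 G3. G1 \<in> P1 \<and> G2 \<in> P2 \<and> G3 \<in> P3}"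

definition sudoku_hypercube ::
  "nat \<Rightarrow> nat \<times> nat \<times> nat \<Rightarrow> coord_partitions \<Rightarrow> 's set \<Rightarrow> (cell \<Rightarrow> 's) \<Rightarrow> bool" where
  "sudoku_hypercube n b P S L \<longleftrightarrow>
     block_partition n b P \<and> latin_hypercube n S L \<and>
     (\<forall>B\<in>blocks P. each_symbol_once L S B)"

definition orthogonal_hypercubes :: "nat \<Rightarrow> (cell \<Rightarrow> 's) \<Rightarrow> (cell \<Rightarrow> 't) \<Rightarrow> bool" where
  "orthogonal_hypercubes n L M \<longleftrightarrow> inj_on (\<lambda>x. (L x, M x)) (cells n)"

text \<open>Families are indexed, and each member \<open>L i\<close> has its own alphabet \<open>S i\<close>. For \<open>n > 1\<close> no Latin
  hypercube is orthogonal to itself, so distinct indices give hypercubes that differ on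
  \<open>cells n\<close>, and the size of the family is the cardinality of the index set.\<close>

definition mutually_orthogonal_sudoku_family ::
  "nat \<Rightarrow> nat \<times> nat \<times> nat \<Rightarrow> coord_partitions \<Rightarrow> 'i set \<Rightarrow> ('i \<Rightarrow> 's set) \<Rightarrow> ('i \<Rightarrow> cell \<Rightarrow> 's) \<Rightarrow> bool"
  where
  "mutually_orthogonal_sudoku_family n b P I S L \<longleftrightarrow>
     (\<forall>i\<in>I. sudoku_hypercube n b P (S i) (L i)) \<and>
     pairwise (\<lambda>i j. orthogonal_hypercubes n (L i) (L j)) I"

definition exists_family_of_size :: "nat \<Rightarrow> nat \<times> nat \<times> nat \<Rightarrow> nat \<Rightarrow> bool" where
  "exists_family_of_size n b k \<longleftrightarrow>
     (\<exists>P (S :: nat \<Rightarrow> nat set) L. block_partition n b P \<and>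
        mutually_orthogonal_sudoku_family n b P {..<k} S L)"

end

theory Submission
  imports "HOL-Algebra.Algebraic_Closure" "HOL-Number_Theory.Residues" Defs
begin

text \<open>
  Let \<open>K\<close> be the field with \<open>q\<close> elements inside the field \<open>E\<close> with \<open>n = q^3\<close> elements, and index each
  coordinate by \<open>E\<close>. For nonzero \<open>a\<close>, \<open>b\<close> in \<open>E\<close> the hypercube \<open>(x, y, z) \<mapsto> (y - a x, z - b x)\<close> has the
  alphabet \<open>E \<times> E\<close>. Two cells carry the same symbol exactly if they differ by an element of the line
  \<open>{(x, a x, b x)}\<close>, so the hypercube is Latin, and lines of different pairs \<open>(a, b)\<close> meet only in \<open>0\<close>,
  so different pairs give orthogonal hypercubes. If the groups of the three coordinates are the cosets
  of additive subgroups \<open>U1\<close>, \<open>U2\<close>, \<open>U3\<close> of \<open>E\<close>, the Sudoku condition says that no nonzero \<open>x\<close> satisfies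
  \<open>x \<in> U1\<close>, \<open>a x \<in> U2\<close> and \<open>b x \<in> U3\<close> (\<open>exists_family_of_multiplications\<close>). Each block size comes from
  one choice of subspaces, and the family sizes count the admissible pairs:

  \<^item> for three equal planes it is enough that \<open>1\<close>, \<open>a\<close>, \<open>b\<close> are linearly independent over \<open>K\<close>, which leaves
    \<open>(q^3 - q) * (q^3 - q^2)\<close> pairs;
  \<^item> for \<open>E\<close>, a plane \<open>U\<close> and \<open>K\<close> it is enough that \<open>a / b\<close> lies outside \<open>U\<close>, which leaves
    \<open>(q^3 - q^2) * (q^3 - 1)\<close> pairs;
  \<^item> for \<open>E\<close>, \<open>E\<close> and \<open>{0}\<close> every pair of nonzero elements will do.

  The upper bounds hold for all families. Fix a cell \<open>x\<close> and a set \<open>B\<close> of cells that does not contain \<open>x\<close>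
  but contains every symbol of every member once. Each member repeats its symbol of \<open>x\<close> at a cell of \<open>B\<close>
  that shares no coordinate with \<open>x\<close>, and by orthogonality these cells differ from member to member
  (\<open>orthogonal_family_card_le\<close>). A suitable block, or a hyperplane, as \<open>B\<close> makes the count agree with the
  size of the constructed family.

  The field \<open>E\<close> and its subfield are found in an algebraic closure of the prime field, as the fixed
  points of powers of the Frobenius map (\<open>exists_finite_field_extension\<close>).
\<close>

section \<open>Latin hypercubes and upper bounds\<close>

lemma each_symbol_onceI_inj:
  assumes "finite S" "card A = card S" "L \<in> A \<rightarrow> S" "inj_on L A"
  shows "each_symbol_once L S A"
proof -
  have "L ` A = S"
    using assms by (intro card_subset_eq) (auto simp: card_image)
  then show ?thesis
    using assms(4) unfolding each_symbol_once_def inj_on_def by blast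
qed

lemma hyperplane_cases:
  assumes "H \<in> hyperplanes n"
  obtains c where "c \<in> {1..n}" "H = {c} \<times> {1..n} \<times> {1..n}"
  | c where "c \<in> {1..n}" "H = {1..n} \<times> {c} \<times> {1..n}"
  | c where "c \<in> {1..n}" "H = {1..n} \<times> {1..n} \<times> {c}"
  using assms unfolding hyperplanes_def by blast

definition share_coordinate :: "cell \<Rightarrow> cell \<Rightarrow> bool" where
  "share_coordinate x y \<longleftrightarrow> fst x = fst y \<or> fst (snd x) = fst (snd y) \<or> snd (snd x) = snd (snd y)"

lemma share_coordinate_iff_hyperplane:
  assumes "x \<in> cells n" "y \<in> cells n"
  shows "share_coordinate x y \<longleftrightarrow> (\<exists>H\<in>hyperplanes n. x \<in> H \<and> y \<in> H)"
proof
  assume "share_coordinate x y"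
  obtain x1 x2 x3 y1 y2 y3 where x: "x = (x1, x2, x3)" and y: "y = (y1, y2, y3)"
    by (metis prod.exhaust)
  consider "x1 = y1" | "x2 = y2" | "x3 = y3"
    using \<open>share_coordinate x y\<close> by (auto simp: share_coordinate_def x y)
  then show "\<exists>H\<in>hyperplanes n. x \<in> H \<and> y \<in> H"
  proof cases
    case 1
    then show ?thesis
      using assms x y by (intro bexI[of _ "{x1} \<times> {1..n} \<times> {1..n}"]) (auto simp: cells_def hyperplanes_def)
  next
    case 2
    then show ?thesis
      using assms x y by (intro bexI[of _ "{1..n} \<times> {x2} \<times> {1..n}"]) (auto simp: cells_def hyperplanes_def)
  next
    case 3
    then show ?thesis
      using assms x y by (intro bexI[of _ "{1..n} \<times> {1..n} \<times> {x3}"]) (auto simp: cells_def hyperplanes_def)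
  qed
next
  assume "\<exists>H\<in>hyperplanes n. x \<in> H \<and> y \<in> H"
  then show "share_coordinate x y"
    by (auto simp: share_coordinate_def elim!: hyperplane_cases)
qed

lemma latin_hypercube_eq_imp_eq:
  assumes "latin_hypercube n S L" "x \<in> cells n" "y \<in> cells n" "share_coordinate x y" "L x = L y"
  shows "x = y"
proof -
  obtain H where "H \<in> hyperplanes n" "x \<in> H" "y \<in> H"
    using assms share_coordinate_iff_hyperplane by blast
  moreover have "L x \<in> S"
    using assms unfolding latin_hypercube_def by blast
  ultimately show ?thesis
    using assms unfolding latin_hypercube_def each_symbol_once_def by metis
qed

text \<open>If \<open>y i\<close> is the cell of \<open>B\<close> where \<open>L i\<close> shows the symbol that it has at \<open>x\<close>, then \<open>y i\<close> determines
  \<open>i\<close>: two orthogonal members that both take equal values at \<open>x\<close> and \<open>y i\<close> would repeat a pair of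
  symbols. The Latin property keeps \<open>y i\<close> off the hyperplanes through \<open>x\<close>. Counting the cells that
  remain bounds the family, and the quality of the bound depends on the choice of \<open>B\<close>.\<close>

lemma orthogonal_family_card_le:
  assumes latin: "\<And>i. i \<in> I \<Longrightarrow> latin_hypercube n (S i) (L i)"
    and orth: "pairwise (\<lambda>i j. orthogonal_hypercubes n (L i) (L j)) I"
    and once: "\<And>i. i \<in> I \<Longrightarrow> each_symbol_once (L i) (S i) B"
    and x: "x \<in> cells n" and B: "B \<subseteq> cells n" "x \<notin> B"
    and C: "{y \<in> B. \<not> share_coordinate x y} \<subseteq> C" "finite C"
  shows "finite I \<and> card I \<le> card C"
proof -
  have "\<exists>y. y \<in> B \<and> L i y = L i x" if "i \<in> I" for i
  proof -
    have "L i x \<in> S i"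
      using latin[OF that] x unfolding latin_hypercube_def by blast
    then show ?thesis
      using once[OF that] unfolding each_symbol_once_def by metis
  qed
  then obtain f where f: "f i \<in> B" "L i (f i) = L i x" if "i \<in> I" for i
    by metis
  have "f ` I \<subseteq> C"
  proof (rule image_subsetI)
    fix i assume i: "i \<in> I"
    then have "\<not> share_coordinate x (f i)"
      using latin_hypercube_eq_imp_eq[OF latin[OF i] x, of "f i"] f[OF i] B by auto
    then show "f i \<in> C"
      using C f[OF i] by auto
  qed
  moreover have "inj_on f I"
  proof (rule inj_onI, rule ccontr)
    fix i j assume ij: "i \<in> I" "j \<in> I" "f i = f j" "i \<noteq> j"
    then have "inj_on (\<lambda>y. (L i y, L j y)) (cells n)"
      using orth unfolding pairwise_def orthogonal_hypercubes_def by blast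
    moreover have "(L i (f i), L j (f i)) = (L i x, L j x)"
      using f ij by metis
    ultimately have "f i = x"
      using x f(1) B ij by (auto dest: inj_onD)
    then show False
      using f(1) ij(1) B(2) by metis
  qed
  ultimately show ?thesis
    using C(2) by (meson card_inj_on_le inj_on_finite)
qed

text \<open>Counting all cells outside the block of \<open>x\<close> that share no coordinate with \<open>x\<close> gives too much here. The sharp
  bound comes from one block \<open>B\<close> that agrees with the block of \<open>x\<close> in the third group but not in the
  second: of its \<open>q^3 * q^2 * q\<close> cells, those that avoid the first and the third coordinate of \<open>x\<close> number
  \<open>(q^3 - 1) * q^2 * (q - 1)\<close>, while its second coordinates avoid that of \<open>x\<close> anyway.\<close>

lemma block_q3_q2_q_family_card_le:
  assumes q: "2 \<le> q" and P: "block_partition (q^3) (q^3, q^2, q) P"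
    and fam: "mutually_orthogonal_sudoku_family (q^3) (q^3, q^2, q) P I S L"
  shows "finite I \<and> card I \<le> q^2 * (q - 1) * (q^3 - 1)"
proof -
  define n where "n = q ^ 3"
  obtain P1 P2 P3 where P_eq: "P = (P1, P2, P3)" by (cases P)
  have part: "partition_on {1..n} P1" "partition_on {1..n} P2" "partition_on {1..n} P3"
    and size: "\<And>G. G \<in> P1 \<Longrightarrow> card G = n" "\<And>G. G \<in> P2 \<Longrightarrow> card G = q^2" "\<And>G. G \<in> P3 \<Longrightarrow> card G = q"
    using P unfolding P_eq by (auto simp: groups_of_size_def n_def)
  have n: "q ^ 2 < n" "1 \<in> {1..n}"
    using q by (auto simp: n_def power_strict_increasing)
  obtain G1 G2 G3 where G: "1 \<in> G1" "G1 \<in> P1" "1 \<in> G2" "G2 \<in> P2" "1 \<in> G3" "G3 \<in> P3"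
    using part n(2) by (metis UnionE partition_onD1)
  have "G2 \<subseteq> {1..n}"
    using part(2) G by (metis Union_upper partition_onD1)
  moreover have "card {1..n} > card G2"
    using size G n by simp
  ultimately obtain c where c: "c \<in> {1..n}" "c \<notin> G2"
    by (metis less_irrefl subsetI subset_antisym)
  then obtain H2 where H2: "H2 \<in> P2" "c \<in> H2"
    using part by (metis UnionE partition_onD1)
  have "1 \<notin> H2"
    using H2 G c partition_onD2[OF part(2)] unfolding disjoint_def by blast
  have sub: "G1 \<subseteq> {1..n}" "H2 \<subseteq> {1..n}" "G3 \<subseteq> {1..n}"
    using part G H2 by (metis Union_upper partition_onD1)+
  let ?C = "(G1 - {1}) \<times> H2 \<times> (G3 - {1})"
  have "finite I \<and> card I \<le> card ?C"
  proof (rule orthogonal_family_card_le[where n = n and B = "G1 \<times> H2 \<times> G3" and x = "(1, 1, 1)"])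
    show "(1, 1, 1) \<in> cells n"
      using n by (simp add: cells_def)
    show "G1 \<times> H2 \<times> G3 \<subseteq> cells n"
      using sub unfolding cells_def by blast
    show "(1, 1, 1) \<notin> G1 \<times> H2 \<times> G3"
      using \<open>1 \<notin> H2\<close> by simp
    show "finite ?C"
      using sub by (meson finite_SigmaI finite_atLeastAtMost finite_Diff finite_subset)
    have "G1 \<times> H2 \<times> G3 \<in> blocks P"
      using G H2 by (auto simp: P_eq)
    then show "each_symbol_once (L i) (S i) (G1 \<times> H2 \<times> G3)" if "i \<in> I" for i
      using fam that unfolding mutually_orthogonal_sudoku_family_def sudoku_hypercube_def by blast
  qed (use fam in \<open>auto simp: mutually_orthogonal_sudoku_family_def sudoku_hypercube_def n_def
        share_coordinate_def\<close>)
  also have "card ?C = (n - 1) * (q ^ 2 * (q - 1))"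
    using size G H2 by (simp add: card_cartesian_product card_Diff_singleton)
  finally show ?thesis
    by (simp add: n_def mult_ac)
qed

text \<open>Blocks of size \<open>(n, n, 1)\<close> are hyperplanes, so the bound in that case is one on orthogonal Latin
  hypercubes. Here \<open>B\<close> is a hyperplane that misses \<open>x\<close>.\<close>

lemma latin_family_card_le:
  assumes n: "2 \<le> n" and latin: "\<And>i. i \<in> I \<Longrightarrow> latin_hypercube n (S i) (L i)"
    and orth: "pairwise (\<lambda>i j. orthogonal_hypercubes n (L i) (L j)) I"
  shows "finite I \<and> card I \<le> (n - 1)^2"
proof -
  let ?B = "{1..n} \<times> {1..n} \<times> {2}"
  let ?C = "{2..n} \<times> {2..n} \<times> {2::nat}"
  have B: "?B \<in> hyperplanes n"
    unfolding hyperplanes_def by (rule UnI2) (use n in \<open>auto intro!: exI[of _ 2]\<close>)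
  have "finite I \<and> card I \<le> card ?C"
  proof (rule orthogonal_family_card_le[where B = ?B and x = "(1, 1, 1)", OF latin orth])
    show "each_symbol_once (L i) (S i) ?B" if "i \<in> I" for i
      using latin[OF that] B unfolding latin_hypercube_def by blast
  qed (use n in \<open>auto simp: cells_def share_coordinate_def\<close>)
  then show ?thesis
    by (simp add: card_cartesian_product power2_eq_square)
qed

section \<open>Finite fields as fixed points of Frobenius powers\<close>

lemma (in cring) binomial_expansion:
  assumes x: "x \<in> carrier R" and y: "y \<in> carrier R"
  shows "(x \<oplus> y) [^] n = (\<Oplus>k\<in>{..n}. [(n choose k)] \<cdot>\<^bsub>R\<^esub> (x [^] k \<otimes> y [^] (n - k)))"
proof (induction n)
  case 0
  show ?case using x y by simp
next
  case (Suc n)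
  define t where "t n k = [(n choose k)] \<cdot>\<^bsub>R\<^esub> (x [^] k \<otimes> y [^] (n - k))" for n k
  have t: "t n k \<in> carrier R" for n k
    using x y by (simp add: t_def)
  define s where "s = (\<Oplus>k\<in>{..n}. t n k)"
  have sx: "s \<otimes> x = (\<Oplus>k\<in>{..n}. [(n choose k)] \<cdot>\<^bsub>R\<^esub> (x [^] Suc k \<otimes> y [^] (n - k)))"
    unfolding s_def using x y t
    by (subst finsum_ldistr) (auto intro!: finsum_cong' simp: t_def add_pow_ldistr add_pow_rdistr m_ac)
  have "s \<otimes> y = (\<Oplus>k\<in>{..n}. t n k \<otimes> y)"
    unfolding s_def using y t by (subst finsum_ldistr) auto
  also have "\<dots> = (\<Oplus>k\<in>{..n}. [(n choose k)] \<cdot>\<^bsub>R\<^esub> (x [^] k \<otimes> y [^] (Suc n - k)))"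
    using x y by (intro finsum_cong') (auto simp: t_def add_pow_ldistr add_pow_rdistr m_ac Suc_diff_le)
  also have "\<dots> = (\<Oplus>k\<in>{..Suc n}. [(n choose k)] \<cdot>\<^bsub>R\<^esub> (x [^] k \<otimes> y [^] (Suc n - k)))"
    using x y by (subst finsum_Suc) (auto simp: binomial_eq_0)
  also have "\<dots> = (\<Oplus>k\<in>{..n}. [(n choose Suc k)] \<cdot>\<^bsub>R\<^esub> (x [^] Suc k \<otimes> y [^] (n - k))) \<oplus> y [^] Suc n"
    using x y by (subst finsum_Suc2) auto
  finally have sy: "s \<otimes> y = \<dots>" .
  have "(x \<oplus> y) [^] Suc n = s \<otimes> x \<oplus> s \<otimes> y"
    using Suc.IH x y t by (simp add: s_def t_def[symmetric] r_distr)
  also have "\<dots> = (\<Oplus>k\<in>{..n}. [(n choose k)] \<cdot>\<^bsub>R\<^esub> (x [^] Suc k \<otimes> y [^] (n - k))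
      \<oplus> [(n choose Suc k)] \<cdot>\<^bsub>R\<^esub> (x [^] Suc k \<otimes> y [^] (n - k))) \<oplus> y [^] Suc n"
    unfolding sx sy using x y by (subst finsum_addf) (auto simp: a_assoc)
  also have "\<dots> = (\<Oplus>k\<in>{..n}. t (Suc n) (Suc k)) \<oplus> t (Suc n) 0"
    using x y by (simp add: t_def add.nat_pow_mult)
  also have "\<dots> = (\<Oplus>k\<in>{..Suc n}. t (Suc n) k)"
    using t by (subst finsum_Suc2) auto
  finally show ?case
    unfolding t_def .
qed

lemma (in ring) add_pow_dvd_eq_zero:
  assumes "[(p::nat)] \<cdot>\<^bsub>R\<^esub> \<one> = \<zero>" "p dvd m" "x \<in> carrier R"
  shows "[m] \<cdot>\<^bsub>R\<^esub> x = \<zero>"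
proof -
  obtain l where m: "m = p * l"
    using assms(2) by blast
  have "[p] \<cdot>\<^bsub>R\<^esub> x = \<zero>"
    using assms add_pow_ldistr[of \<one> x p] by simp
  then show ?thesis
    using assms(3) add.nat_pow_pow[of x l p] by (simp add: m mult.commute)
qed

text \<open>The counterpart of \<open>freshmans_dream'\<close> for rings given by a carrier and operations on it instead of a
  type class. It is applied to a field and to its polynomial ring.\<close>

lemma (in cring) freshmans_dream_power:
  assumes p: "prime (p::nat)" "[p] \<cdot>\<^bsub>R\<^esub> \<one> = \<zero>" and x: "x \<in> carrier R" and y: "y \<in> carrier R"
  shows "(x \<oplus> y) [^] (p ^ k) = x [^] (p ^ k) \<oplus> y [^] (p ^ k)"
proof (induction k)
  case (Suc k)
  define u where "u = x [^] (p ^ k)"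
  define v where "v = y [^] (p ^ k)"
  have uv: "u \<in> carrier R" "v \<in> carrier R"
    using x y by (auto simp: u_def v_def)
  let ?t = "\<lambda>i. [(p choose i)] \<cdot>\<^bsub>R\<^esub> (u [^] i \<otimes> v [^] (p - i))"
  obtain m where m: "p = Suc m"
    using prime_gt_0_nat[OF p(1)] by (cases p) auto
  have "(u \<oplus> v) [^] p = (\<Oplus>i\<in>{..Suc m}. ?t i)"
    using binomial_expansion[OF uv, of p] by (simp only: m)
  also have "\<dots> = ?t (Suc m) \<oplus> (\<Oplus>i\<in>{..m}. ?t i)"
    using uv by (subst finsum_Suc) auto
  \<comment> \<open>The prime \<open>p\<close> divides all binomial coefficients except the two outer ones.\<close>
  also have "(\<Oplus>i\<in>{..m}. ?t i) = (\<Oplus>i\<in>{..m}. if 0 = i then ?t 0 else \<zero>)"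
    using uv p m by (intro finsum_cong') (auto intro!: add_pow_dvd_eq_zero[OF p(2)] dvd_choose_prime)
  also have "\<dots> = ?t 0"
    using uv by (subst add.finprod_singleton) auto
  finally have "(u \<oplus> v) [^] p = u [^] p \<oplus> v [^] p"
    using uv by (simp add: m[symmetric])
  moreover have "(x \<oplus> y) [^] (p ^ Suc k) = (u \<oplus> v) [^] p"
    using x y by (simp add: u_def v_def Suc.IH[symmetric] nat_pow_pow mult.commute)
  ultimately show ?case
    using x y by (simp add: u_def v_def nat_pow_pow mult.commute)
qed (use x y in simp)

lemma (in ring_hom_ring) hom_add_pow:
  assumes "x \<in> carrier R"
  shows "h ([(n::nat)] \<cdot>\<^bsub>R\<^esub> x) = [n] \<cdot>\<^bsub>S\<^esub> h x"
  using assms by (induction n) auto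

text \<open>The map \<open>x \<mapsto> x^(p^k)\<close> is a ring endomorphism in characteristic \<open>p\<close>, so its fixed points form a
  subfield.\<close>

lemma (in field) frobenius_fixed_subfield:
  assumes p: "prime (p::nat)" "[p] \<cdot>\<^bsub>R\<^esub> \<one> = \<zero>"
  shows "subfield {x \<in> carrier R. x [^] (p ^ k) = x} R"
proof (rule subfieldI')
  let ?K = "{x \<in> carrier R. x [^] (p ^ k) = x}"
  have pos: "p ^ k > 0"
    using prime_gt_0_nat[OF p(1)] by simp
  have neg: "\<ominus> x \<in> ?K" if x: "x \<in> ?K" for x
  proof -
    have "(x \<oplus> \<ominus> x) [^] (p ^ k) = x [^] (p ^ k) \<oplus> (\<ominus> x) [^] (p ^ k)"
      using x by (intro freshmans_dream_power[OF p]) auto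
    then have "(\<ominus> x) [^] (p ^ k) \<oplus> x = \<zero>"
      using x pos by (simp add: r_neg nat_pow_zero a_comm)
    then have "\<ominus> x = (\<ominus> x) [^] (p ^ k)"
      using x by (intro minus_equality) auto
    then show ?thesis
      using x by simp
  qed
  show "subring ?K R"
    by (rule subringI) (use neg p in \<open>auto simp: nat_pow_distrib freshmans_dream_power nat_pow_one\<close>)
  show "inv x \<in> ?K" if x: "x \<in> ?K - {\<zero>}" for x
  proof -
    have "x \<in> Units R"
      using x field_Units by blast
    moreover have "x [^] (p ^ k) \<otimes> (inv x) [^] (p ^ k) = \<one>"
      using calculation x by (metis (no_types, lifting) DiffE Units_inv_closed Units_r_inv mem_Collect_eq nat_pow_distrib nat_pow_one)
    ultimately show ?thesis
      using x by (metis (mono_tags, lifting) Diff_iff Units_inv_closed comm_inv_char mem_Collect_eq nat_pow_closed)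
  qed
qed

lemma (in cring) add_minus_add_cancel:
  assumes "x \<in> carrier R" "y \<in> carrier R" "z \<in> carrier R"
  shows "(x \<oplus> z) \<ominus> (y \<oplus> z) = x \<ominus> y"
  using assms by algebra

text \<open>The fixed points are the roots of \<open>f = X^N - X\<close> with \<open>N = p^k\<close>, and \<open>f\<close> splits, so it suffices that
  all roots are simple. If \<open>a\<close> is a root, then the freshman's dream in the polynomial ring gives
  \<open>f = (X - a)^N - (X - a)\<close>, whose cofactor \<open>(X - a)^(N - 1) - 1\<close> takes the value \<open>-1\<close> at \<open>a\<close>.\<close>

theorem (in algebraically_closed) card_frobenius_fixed:
  assumes p: "prime (p::nat)" "[p] \<cdot>\<^bsub>L\<^esub> \<one> = \<zero>" and k: "k > 0"
  shows "card {x \<in> carrier L. x [^] (p ^ k) = x} = p ^ k"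
proof -
  define N where "N = p ^ k"
  have N: "N > 1"
    using prime_gt_1_nat[OF p(1)] k unfolding N_def by (rule one_less_power)
  let ?UP = "poly_ring L"
  interpret UP: domain ?UP
    by (rule univ_poly_is_domain[OF carrier_is_subring])
  interpret const: ring_hom_ring L ?UP poly_of_const
    using canonical_embedding_ring_hom[OF carrier_is_subring] by simp
  have X: "X \<in> carrier ?UP"
    by (rule var_closed(1)[OF carrier_is_subring])
  define f where "f = X [^]\<^bsub>?UP\<^esub> N \<ominus>\<^bsub>?UP\<^esub> X"
  have f: "f \<in> carrier ?UP"
    using X by (simp add: f_def)
  have deg: "degree f = N"
  proof -
    have XN: "X [^]\<^bsub>?UP\<^esub> N = monom \<one> N"
      by (rule unitary_monom_eq_var_pow[OF carrier_is_subring, symmetric])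
    have "degree (X [^]\<^bsub>?UP\<^esub> N) = N"
      unfolding XN by (simp add: monom_def)
    moreover have "degree (\<ominus>\<^bsub>?UP\<^esub> X) = 1"
      using univ_poly_a_inv_degree[OF carrier_is_subring X] by (simp add: var_def)
    ultimately show ?thesis
      unfolding f_def a_minus_def univ_poly_add using N X poly_add_degree_eq[OF carrier_is_subring]
      by (simp add: univ_poly_carrier)
  qed
  then have f_nz: "f \<noteq> []"
    using N by auto
  have root_iff: "is_root f x \<longleftrightarrow> x \<in> carrier L \<and> x [^] N = x" for x
  proof (cases "x \<in> carrier L")
    case True
    interpret ev: ring_hom_ring ?UP L "\<lambda>q. eval q x"
      by (rule eval_ring_hom[OF carrier_is_subring True])
    have "eval f x = x [^] N \<ominus> x"
      using True X by (simp add: f_def a_minus_def ev.hom_nat_pow eval_var)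
    then show ?thesis
      using True f_nz by (simp add: is_root_def)
  qed (simp add: is_root_def)
  have "count (roots f) a \<le> 1" for a
  proof (rule ccontr)
    assume "\<not> ?thesis"
    then have mult: "alg_mult f a \<ge> 2"
      using alg_mult_eq_count_roots[OF f] by simp
    then have "is_root f a"
      using alg_mult_gt_zero_iff_is_root[OF f, of a] by simp
    then have a: "a \<in> carrier L" "a [^] N = a"
      using root_iff by auto
    interpret ev: ring_hom_ring ?UP L "\<lambda>q. eval q a"
      by (rule eval_ring_hom[OF carrier_is_subring a(1)])
    define c where "c = poly_of_const a"
    define Y where "Y = X \<ominus>\<^bsub>?UP\<^esub> c"
    have c: "c \<in> carrier ?UP"
      using a by (simp add: c_def)
    have Y: "Y \<in> carrier ?UP"
      using X c by (simp add: Y_def)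
    have Y_list: "Y = [\<one>, \<ominus> a]"
      unfolding Y_def a_minus_def univ_poly_a_inv_def'[OF carrier_is_subring c] univ_poly_add
      using a by (auto simp: c_def poly_of_const_def var_def)
    have X_eq: "X = Y \<oplus>\<^bsub>?UP\<^esub> c"
      using X c by (simp add: Y_def UP.minus_eq UP.a_assoc UP.l_neg)
    have "[p] \<cdot>\<^bsub>?UP\<^esub> \<one>\<^bsub>?UP\<^esub> = \<zero>\<^bsub>?UP\<^esub>"
      using const.hom_add_pow[of \<one> p] p(2) by simp
    then have "X [^]\<^bsub>?UP\<^esub> N = Y [^]\<^bsub>?UP\<^esub> N \<oplus>\<^bsub>?UP\<^esub> c [^]\<^bsub>?UP\<^esub> N"
      unfolding X_eq N_def using p(1) Y c by (intro UP.freshmans_dream_power)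
    also have "c [^]\<^bsub>?UP\<^esub> N = c"
      using a const.hom_nat_pow[of a N] by (simp add: c_def)
    finally have "f = (Y [^]\<^bsub>?UP\<^esub> N \<oplus>\<^bsub>?UP\<^esub> c) \<ominus>\<^bsub>?UP\<^esub> (Y \<oplus>\<^bsub>?UP\<^esub> c)"
      unfolding f_def by (simp add: X_eq[symmetric])
    also have "\<dots> = Y [^]\<^bsub>?UP\<^esub> N \<ominus>\<^bsub>?UP\<^esub> Y"
      using Y c by (intro UP.add_minus_add_cancel) auto
    also have "\<dots> = Y \<otimes>\<^bsub>?UP\<^esub> (Y [^]\<^bsub>?UP\<^esub> (N - 1) \<ominus>\<^bsub>?UP\<^esub> \<one>\<^bsub>?UP\<^esub>)"
    proof -
      have "Y [^]\<^bsub>?UP\<^esub> N = Y \<otimes>\<^bsub>?UP\<^esub> Y [^]\<^bsub>?UP\<^esub> (N - 1)"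
        using N Y UP.nat_pow_Suc2[OF Y, of "N - 1"] by simp
      then show ?thesis
        using Y by (simp add: UP.minus_eq UP.r_distr UP.r_minus)
    qed
    finally have f_eq: "f = Y \<otimes>\<^bsub>?UP\<^esub> (Y [^]\<^bsub>?UP\<^esub> (N - 1) \<ominus>\<^bsub>?UP\<^esub> \<one>\<^bsub>?UP\<^esub>)" .
    have "(Y [^]\<^bsub>?UP\<^esub> (2::nat)) pdivides f"
      using le_alg_mult_imp_pdivides[OF a(1) f mult] by (simp add: Y_list)
    then obtain r where r: "r \<in> carrier ?UP" "f = Y [^]\<^bsub>?UP\<^esub> (2::nat) \<otimes>\<^bsub>?UP\<^esub> r"
      unfolding pdivides_def by blast
    have "f = Y \<otimes>\<^bsub>?UP\<^esub> (Y \<otimes>\<^bsub>?UP\<^esub> r)"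
      unfolding r(2) using r(1) Y by (simp add: numeral_2_eq_2 UP.m_assoc)
    moreover have "Y \<noteq> \<zero>\<^bsub>?UP\<^esub>"
      by (simp add: Y_list univ_poly_zero)
    ultimately have "Y [^]\<^bsub>?UP\<^esub> (N - 1) \<ominus>\<^bsub>?UP\<^esub> \<one>\<^bsub>?UP\<^esub> = Y \<otimes>\<^bsub>?UP\<^esub> r"
      using f_eq Y r(1) by (metis UP.m_closed UP.m_lcancel UP.minus_closed UP.nat_pow_closed UP.one_closed)
    then have "eval (Y [^]\<^bsub>?UP\<^esub> (N - 1) \<ominus>\<^bsub>?UP\<^esub> \<one>\<^bsub>?UP\<^esub>) a = eval (Y \<otimes>\<^bsub>?UP\<^esub> r) a"
      by simp
    moreover have "eval Y a = \<zero>"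
      unfolding Y_list using a by (simp add: r_neg)
    ultimately have "\<zero> [^] (N - 1) \<ominus> \<one> = \<zero>"
      using Y r(1) ev.hom_closed[OF r(1)] by (simp add: UP.minus_eq ev.hom_nat_pow a_minus_def)
    then show False
      using N by (simp add: nat_pow_zero)
  qed
  then have "mset_set (set_mset (roots f)) = roots f"
    by (intro multiset_eqI) (metis count_eq_zero_iff count_mset_set(1,3) finite_set_mset le_neq_implies_less less_one)
  moreover have "size (roots f) = N"
    using roots_over_carrier[OF f] deg by (simp add: splitted_def)
  moreover have "set_mset (roots f) = {x \<in> carrier L. x [^] N = x}"
    using roots_mem_iff_is_root[OF f] root_iff by auto
  ultimately show ?thesis
    unfolding N_def by (metis size_mset_set)
qed

lemma exists_algebraically_closed_of_char:
  assumes "prime (p::nat)"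
  shows "\<exists>L :: ((int list \<times> nat) multiset \<Rightarrow> int) ring. algebraically_closed L \<and> [p] \<cdot>\<^bsub>L\<^esub> \<one>\<^bsub>L\<^esub> = \<zero>\<^bsub>L\<^esub>"
proof -
  let ?R = "residue_ring (int p)"
  interpret R: residues_prime p ?R
    by unfold_locales (use assms in simp_all)
  interpret L: algebraic_closure R.alg_closure "R.indexed_const ` carrier ?R"
    by (rule R.alg_closureE)
  interpret h: ring_hom_ring ?R R.alg_closure R.indexed_const
    using R.alg_closureE(2) by (intro ring_hom_ringI2 R.ring_axioms L.ring_axioms)
  have "card (carrier ?R) = p"
    by (simp add: R.res_carrier_eq)
  then have "[p] \<cdot>\<^bsub>?R\<^esub> \<one>\<^bsub>?R\<^esub> = \<zero>\<^bsub>?R\<^esub>"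
    using R.add.pow_order_eq_1[of "\<one>\<^bsub>?R\<^esub>"] by (simp add: order_def)
  then have "[p] \<cdot>\<^bsub>R.alg_closure\<^esub> \<one>\<^bsub>R.alg_closure\<^esub> = \<zero>\<^bsub>R.alg_closure\<^esub>"
    using h.hom_add_pow[of "\<one>\<^bsub>?R\<^esub>" p] by simp
  then show ?thesis
    using L.algebraically_closed_axioms by blast
qed

text \<open>Both fields are sets of fixed points, of \<open>x \<mapsto> x^q\<close> and of \<open>x \<mapsto> x^(q^d)\<close>, in one algebraic closure
  of the prime field; the second map is a power of the first.\<close>

theorem exists_finite_field_extension:
  assumes q: "primepow q" and d: "d > 0"
  shows "\<exists>(R :: ((int list \<times> nat) multiset \<Rightarrow> int) ring) K.
    field R \<and> subfield K R \<and> card (carrier R) = q ^ d \<and> card K = q"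
proof -
  obtain p k where p: "prime p" and k: "k > 0" and q_eq: "q = p ^ k"
    using q unfolding primepow_def by blast
  obtain L :: "((int list \<times> nat) multiset \<Rightarrow> int) ring"
    where L: "algebraically_closed L" and char: "[p] \<cdot>\<^bsub>L\<^esub> \<one>\<^bsub>L\<^esub> = \<zero>\<^bsub>L\<^esub>"
    using exists_algebraically_closed_of_char[OF p] by blast
  interpret algebraically_closed L
    by (rule L)
  define E where "E m = {x \<in> carrier L. x [^]\<^bsub>L\<^esub> (p ^ m) = x}" for m
  have sub: "subfield (E m) L" for m
    unfolding E_def by (rule frobenius_fixed_subfield[OF p char])
  have card_fix: "card (E m) = p ^ m" if "m > 0" for m
    unfolding E_def by (rule card_frobenius_fixed[OF p char that])
  have "E k \<subseteq> E (k * m)" for m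
  proof
    fix x assume x: "x \<in> E k"
    then show "x \<in> E (k * m)"
    proof (induction m)
      case (Suc m)
      then have "x [^]\<^bsub>L\<^esub> (p ^ k * p ^ (k * m)) = x"
        by (simp add: E_def nat_pow_pow[symmetric])
      then show ?case
        using Suc by (simp add: E_def power_add)
    qed (simp add: E_def)
  qed
  then have incl: "E k \<subseteq> E (k * d)" .
  let ?R = "L\<lparr>carrier := E (k * d)\<rparr>"
  have R: "field ?R"
    using subfield_iff(2)[OF sub] .
  have "subfield (E k) ?R"
  proof (rule ring.subfield_iff(1))
    show "ring ?R"
      using R by (simp add: field.is_ring)
    show "field (?R\<lparr>carrier := E k\<rparr>)"
      using subfield_iff(2)[OF sub[of k]] by simp
  qed (use incl in simp)
  then show ?thesis
    using R card_fix[of k] card_fix[of "k * d"] k d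
    by (intro exI[of _ ?R] exI[of _ "E k"]) (auto simp: q_eq power_mult)
qed

section \<open>Hypercubes from multiplications in a field\<close>

lemma (in group) groups_of_size_cosets:
  assumes H: "subgroup H G" and h: "bij_betw h (carrier G) {1..n}"
  shows "groups_of_size n (card H) ((`) h ` (rcosets H))"
  unfolding groups_of_size_def
proof (intro conjI ballI)
  have sub: "C \<subseteq> carrier G" if "C \<in> rcosets H" for C
    using rcosets_part_G[OF H] that by blast
  have part: "partition_on (carrier G) (rcosets H)"
  proof (rule partition_onI)
    show "\<Union> (rcosets H) = carrier G"
      by (rule rcosets_part_G[OF H])
    show "{} \<notin> rcosets H"
      using H subgroup.one_closed unfolding RCOSETS_def r_coset_def by blast
    show "\<And>p q. p \<in> rcosets H \<Longrightarrow> q \<in> rcosets H \<Longrightarrow> p \<noteq> q \<Longrightarrow> disjnt p q"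
      using rcos_disjoint[OF H] unfolding pairwise_def by blast
  qed
  then have "partition_on (h ` carrier G) ((`) h ` (rcosets H) - {{}})"
    using h by (intro partition_on_inj_image[OF part]) (auto simp: bij_betw_def)
  moreover have "(`) h ` (rcosets H) - {{}} = (`) h ` (rcosets H)"
    using partition_onD3[OF part] by auto
  ultimately show "partition_on {1..n} ((`) h ` (rcosets H))"
    using h by (simp add: bij_betw_def)
  fix K assume "K \<in> (`) h ` (rcosets H)"
  then obtain C where C: "C \<in> rcosets H" "K = h ` C"
    by blast
  then have "card K = card C"
    using h sub by (metis bij_betw_def card_image inj_on_subset)
  then show "card K = card H"
    using card_rcosets_equal[OF C(1)] H by (simp add: subgroup.subset)
qed

context field
begin

text \<open>The hypercube of the pair \<open>(a, b)\<close> before coordinates and symbols are renamed to numbers. It is a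
  linear map whose kernel is the line \<open>{(x, a x, b x)}\<close>, and the fibre of every symbol is a translate
  of that line.\<close>

definition shear :: "'a \<Rightarrow> 'a \<Rightarrow> 'a \<times> 'a \<times> 'a \<Rightarrow> 'a \<times> 'a" where
  "shear a b = (\<lambda>(x, y, z). (y \<ominus> a \<otimes> x, z \<ominus> b \<otimes> x))"

lemma minus_mult_eq_iff:
  assumes "a \<in> carrier R" "x \<in> carrier R" "x' \<in> carrier R" "y \<in> carrier R" "y' \<in> carrier R"
  shows "y \<ominus> a \<otimes> x = y' \<ominus> a \<otimes> x' \<longleftrightarrow> y \<ominus> y' = a \<otimes> (x \<ominus> x')"
proof -
  have "y \<ominus> a \<otimes> x = y' \<ominus> a \<otimes> x' \<longleftrightarrow> (y \<ominus> a \<otimes> x) \<ominus> (y' \<ominus> a \<otimes> x') = \<zero>"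
    using assms by simp
  also have "(y \<ominus> a \<otimes> x) \<ominus> (y' \<ominus> a \<otimes> x') = (y \<ominus> y') \<ominus> a \<otimes> (x \<ominus> x')"
    using assms by algebra
  also have "\<dots> = \<zero> \<longleftrightarrow> y \<ominus> y' = a \<otimes> (x \<ominus> x')"
    using assms by simp
  finally show ?thesis .
qed

lemma shear_eq_iff:
  assumes "a \<in> carrier R" "b \<in> carrier R" "x \<in> carrier R" "x' \<in> carrier R"
    "y \<in> carrier R" "y' \<in> carrier R" "z \<in> carrier R" "z' \<in> carrier R"
  shows "shear a b (x, y, z) = shear a b (x', y', z') \<longleftrightarrow>
    y \<ominus> y' = a \<otimes> (x \<ominus> x') \<and> z \<ominus> z' = b \<otimes> (x \<ominus> x')"
  using assms by (simp add: shear_def minus_mult_eq_iff)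

lemma inj_on_shear:
  assumes ab: "a \<in> carrier R" "b \<in> carrier R" and A: "A \<subseteq> carrier R \<times> carrier R \<times> carrier R"
    and fst_eq: "\<And>x y z x' y' z'. (x, y, z) \<in> A \<Longrightarrow> (x', y', z') \<in> A \<Longrightarrow>
      y \<ominus> y' = a \<otimes> (x \<ominus> x') \<Longrightarrow> z \<ominus> z' = b \<otimes> (x \<ominus> x') \<Longrightarrow> x = x'"
  shows "inj_on (shear a b) A"
proof (rule inj_onI)
  fix u v assume uv: "u \<in> A" "v \<in> A" "shear a b u = shear a b v"
  obtain x y z x' y' z' where u: "u = (x, y, z)" and v: "v = (x', y', z')"
    by (metis prod.exhaust)
  have carr: "x \<in> carrier R" "x' \<in> carrier R" "y \<in> carrier R" "y' \<in> carrier R"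
    "z \<in> carrier R" "z' \<in> carrier R"
    using A uv u v by auto
  have eqs: "y \<ominus> y' = a \<otimes> (x \<ominus> x')" "z \<ominus> z' = b \<otimes> (x \<ominus> x')"
    using uv(3) carr ab by (auto simp: u v shear_eq_iff)
  have x: "x = x'"
    using fst_eq uv(1,2) u v eqs by blast
  have "y \<ominus> y' = \<zero>" "z \<ominus> z' = \<zero>"
    using eqs x carr ab by (simp_all del: r_right_minus_eq add: a_minus_def r_neg)
  then show "u = v"
    using x carr by (simp add: u v)
qed

text \<open>Blocks are products of cosets of \<open>U1\<close>, \<open>U2\<close>, \<open>U3\<close>. A set of \<open>n^2\<close> cells contains every symbol exactly
  once as soon as no symbol repeats in it, and two cells with equal symbols differ by some
  \<open>(x, a x, b x)\<close>. In a hyperplane one of these three entries vanishes, hence all do because \<open>a\<close> and \<open>b\<close>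
  are invertible; in a block they lie in \<open>U1\<close>, \<open>U2\<close> and \<open>U3\<close>, so \<open>x = 0\<close> by the last hypothesis.
  Equal pairs of symbols for \<open>(a, b)\<close> and \<open>(a', b')\<close> give \<open>a x = a' x\<close> and \<open>b x = b' x\<close>, so \<open>x = 0\<close>.\<close>

theorem exists_family_of_multiplications:
  assumes fin: "finite (carrier R)"
    and U: "subgroup U1 (add_monoid R)" "subgroup U2 (add_monoid R)" "subgroup U3 (add_monoid R)"
    and card_U: "card U1 * card U2 * card U3 = (card (carrier R))^2"
    and A: "A \<subseteq> (carrier R - {\<zero>}) \<times> (carrier R - {\<zero>})"
    and triv: "\<And>a b x. (a, b) \<in> A \<Longrightarrow> x \<in> U1 \<Longrightarrow> a \<otimes> x \<in> U2 \<Longrightarrow> b \<otimes> x \<in> U3 \<Longrightarrow> x = \<zero>"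
  shows "exists_family_of_size (card (carrier R)) (card U1, card U2, card U3) (card A)"
proof -
  define n where "n = card (carrier R)"
  obtain g where g: "bij_betw g {1..n} (carrier R)"
    using ex_bij_betw_nat_finite_1[OF fin] n_def by blast
  define h where "h = inv_into {1..n} g"
  have h: "bij_betw h (carrier R) {1..n}"
    unfolding h_def by (rule bij_betw_inv_into[OF g])
  have gh: "g (h x) = x" if "x \<in> carrier R" for x
    using g that by (simp add: h_def bij_betw_inv_into_right)
  have g_carrier: "g i \<in> carrier R" if "i \<in> {1..n}" for i
    using g that by (auto simp: bij_betw_def)
  have g_inj: "i = j" if "g i = g j" "i \<in> {1..n}" "j \<in> {1..n}" for i j
    using g that by (auto simp: bij_betw_def dest: inj_onD)
  obtain e where e: "bij_betw e (carrier R \<times> carrier R) {0..<n^2}"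
    using ex_bij_betw_finite_nat[of "carrier R \<times> carrier R"] fin
    by (auto simp: n_def card_cartesian_product power2_eq_square)
  obtain f where f: "bij_betw f {0..<card A} A"
    using ex_bij_betw_nat_finite[of A] A fin by (meson finite_Diff finite_SigmaI finite_subset)
  define P where "P U = (`) h ` (rcosets\<^bsub>add_monoid R\<^esub> U)" for U
  define G where "G = (\<lambda>(i, j, k). (g i, g j, g k))"
  define L where "L a b = e \<circ> shear a b \<circ> G" for a b

  have diff_mem: "g i \<ominus> g j \<in> U" if U: "subgroup U (add_monoid R)" "K \<in> P U" and ij: "i \<in> K" "j \<in> K" for U K i j
  proof -
    obtain x where x: "x \<in> carrier R" "K = h ` (U #>\<^bsub>add_monoid R\<^esub> x)"
      using U(2) unfolding P_def RCOSETS_def by auto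
    have UR: "U \<subseteq> carrier R"
      using subgroup.subset[OF U(1)] by simp
    obtain u v where uv: "u \<in> U" "v \<in> U" "i = h (u \<oplus> x)" "j = h (v \<oplus> x)"
      using ij x unfolding r_coset_def by auto
    then have "g i \<ominus> g j = (u \<oplus> x) \<ominus> (v \<oplus> x)"
      using uv x UR by (simp add: gh subset_iff)
    also have "\<dots> = u \<oplus> \<ominus> v"
      using uv x UR by (simp add: subset_iff) algebra
    also have "\<dots> \<in> U"
      using uv U(1) by (metis a_inv_def subgroup.m_closed subgroup.m_inv_closed monoid.simps(1) monoid_record_simps(1))
    finally show ?thesis .
  qed
  have P_groups: "groups_of_size n (card U) (P U)" if "subgroup U (add_monoid R)" for U
    unfolding P_def using add.group_axioms that h by (intro group.groups_of_size_cosets) auto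
  have P_sub: "K \<subseteq> {1..n}" if "subgroup U (add_monoid R)" "K \<in> P U" for U K
    using P_groups[OF that(1)] that(2) unfolding groups_of_size_def by (metis Union_upper partition_onD1)
  have dvd: "card U dvd n" if "subgroup U (add_monoid R)" for U
    using group.lagrange[OF add.group_axioms that] by (metis dvd_triv_right n_def order_def partial_object.select_convs(1))
  have part: "block_partition n (card U1, card U2, card U3) (P U1, P U2, P U3)"
    using U card_U P_groups dvd by (simp add: n_def)

  have G_mem: "G c \<in> carrier R \<times> carrier R \<times> carrier R" if "c \<in> cells n" for c
    using that g_carrier by (auto simp: G_def cells_def)
  have G_inj: "inj_on G (cells n)"
    by (rule inj_onI) (auto simp: G_def cells_def intro!: g_inj)
  have shear_mem: "shear a b u \<in> carrier R \<times> carrier R"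
    if "u \<in> carrier R \<times> carrier R \<times> carrier R" "(a, b) \<in> A" for a b u
    using that A by (auto simp: shear_def)
  have L_mem: "L a b \<in> B \<rightarrow> {0..<n^2}" if "(a, b) \<in> A" "B \<subseteq> cells n" for a b B
  proof
    fix c assume "c \<in> B"
    then have "shear a b (G c) \<in> carrier R \<times> carrier R"
      using that G_mem shear_mem by blast
    then have "e (shear a b (G c)) \<in> {0..<n^2}"
      by (rule bij_betwE[OF e, rule_format])
    then show "L a b c \<in> {0..<n^2}"
      by (simp add: L_def)
  qed

  \<comment> \<open>Cells with equal symbols agree as soon as their first coordinates do, so only these are compared.\<close>
  have once: "each_symbol_once (L a b) {0..<n^2} B"
    if ab: "(a, b) \<in> A" and B: "B \<subseteq> cells n" "card B = n^2"
      and eq: "\<And>i j k i' j' k'. (i, j, k) \<in> B \<Longrightarrow> (i', j', k') \<in> B \<Longrightarrow>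
        g j \<ominus> g j' = a \<otimes> (g i \<ominus> g i') \<Longrightarrow> g k \<ominus> g k' = b \<otimes> (g i \<ominus> g i') \<Longrightarrow> g i = g i'"
    for a b B
  proof (rule each_symbol_onceI_inj)
    have ab': "a \<in> carrier R" "b \<in> carrier R"
      using A ab by auto
    have G_B: "G ` B \<subseteq> carrier R \<times> carrier R \<times> carrier R"
      using B(1) G_mem by blast
    then have shear_B: "shear a b ` G ` B \<subseteq> carrier R \<times> carrier R"
      using ab shear_mem by blast
    show "L a b \<in> B \<rightarrow> {0..<n^2}"
      by (rule L_mem[OF ab B(1)])
    have "inj_on G B"
      using G_inj B(1) by (rule inj_on_subset)
    moreover have "inj_on (shear a b) (G ` B)"
      using eq by (intro inj_on_shear[OF ab' G_B]) (auto simp: G_def)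
    moreover have "inj_on e (shear a b ` G ` B)"
      using e shear_B by (meson bij_betw_def inj_on_subset)
    ultimately show "inj_on (L a b) B"
      unfolding L_def by (intro comp_inj_on) (simp_all add: image_comp)
  qed (use B in auto)

  have sudoku: "sudoku_hypercube n (card U1, card U2, card U3) (P U1, P U2, P U3) {0..<n^2} (L a b)"
    if ab: "(a, b) \<in> A" for a b
    unfolding sudoku_hypercube_def latin_hypercube_def
  proof (intro conjI ballI)
    have ab': "a \<in> carrier R" "b \<in> carrier R" "a \<noteq> \<zero>" "b \<noteq> \<zero>"
      using A ab by auto
    show "each_symbol_once (L a b) {0..<n^2} H" if "H \<in> hyperplanes n" for H
      using that
    proof (cases rule: hyperplane_cases)
      case (1 c)
      show ?thesis
        by (rule once[OF ab]) (use 1 in \<open>auto simp: cells_def card_cartesian_product power2_eq_square\<close>)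
    next
      case (2 c)
      then show ?thesis
        using ab' g_carrier integral
        by (intro once[OF ab]) (auto simp: cells_def card_cartesian_product power2_eq_square, metis minus_closed r_right_minus_eq)
    next
      case (3 c)
      then show ?thesis
        using ab' g_carrier integral
        by (intro once[OF ab]) (auto simp: cells_def card_cartesian_product power2_eq_square, metis minus_closed r_right_minus_eq)
    qed
    show "each_symbol_once (L a b) {0..<n^2} B" if B: "B \<in> blocks (P U1, P U2, P U3)" for B
    proof -
      obtain K1 K2 K3 where K: "K1 \<in> P U1" "K2 \<in> P U2" "K3 \<in> P U3" "B = K1 \<times> K2 \<times> K3"
        using B by auto
      have sub: "K1 \<subseteq> {1..n}" "K2 \<subseteq> {1..n}" "K3 \<subseteq> {1..n}"
        using P_sub U K by blast+
      show ?thesis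
      proof (rule once[OF ab])
        show "B \<subseteq> cells n"
          using sub K(4) unfolding cells_def by blast
        show "card B = n^2"
          using P_groups U K card_U by (simp add: card_cartesian_product groups_of_size_def n_def)
        fix i j k i' j' k'
        assume B: "(i, j, k) \<in> B" "(i', j', k') \<in> B"
          and eqs: "g j \<ominus> g j' = a \<otimes> (g i \<ominus> g i')" "g k \<ominus> g k' = b \<otimes> (g i \<ominus> g i')"
        have "g i \<ominus> g i' \<in> U1" "g j \<ominus> g j' \<in> U2" "g k \<ominus> g k' \<in> U3"
          using B K U diff_mem by auto
        then have "g i \<ominus> g i' = \<zero>"
          using triv[OF ab] eqs by simp
        moreover have "g i \<in> carrier R" "g i' \<in> carrier R"
          using B sub K(4) g_carrier by blast+
        ultimately show "g i = g i'"
          by simp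
      qed
    qed
    show "L a b \<in> cells n \<rightarrow> {0..<n\<^sup>2}"
      by (rule L_mem[OF ab order_refl])
  qed (use part in auto)

  have orth: "orthogonal_hypercubes n (L a b) (L a' b')"
    if ab: "(a, b) \<in> A" "(a', b') \<in> A" "(a, b) \<noteq> (a', b')" for a b a' b'
    unfolding orthogonal_hypercubes_def
  proof (rule inj_onI)
    fix c d assume cd: "c \<in> cells n" "d \<in> cells n" "(L a b c, L a' b' c) = (L a b d, L a' b' d)"
    have ab': "a \<in> carrier R" "b \<in> carrier R" "a' \<in> carrier R" "b' \<in> carrier R"
      using A ab by auto
    obtain i j k i' j' k' where c: "c = (i, j, k)" and d: "d = (i', j', k')"
      by (metis prod.exhaust)
    have ijk: "{i, j, k, i', j', k'} \<subseteq> {1..n}"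
      using cd(1,2) c d by (auto simp: cells_def)
    then have carr: "g i \<in> carrier R" "g j \<in> carrier R" "g k \<in> carrier R"
      "g i' \<in> carrier R" "g j' \<in> carrier R" "g k' \<in> carrier R"
      using g_carrier by auto
    have shear_eq: "shear u v (G c) = shear u v (G d)" if "L u v c = L u v d" "u \<in> carrier R" "v \<in> carrier R" for u v
    proof -
      have "shear u v (G c) \<in> carrier R \<times> carrier R" "shear u v (G d) \<in> carrier R \<times> carrier R"
        using that carr by (auto simp: c d G_def shear_def)
      then show ?thesis
        using e that unfolding L_def bij_betw_def by (auto dest: inj_onD)
    qed
    have eqs: "g j \<ominus> g j' = a \<otimes> (g i \<ominus> g i')" "g k \<ominus> g k' = b \<otimes> (g i \<ominus> g i')"
      "g j \<ominus> g j' = a' \<otimes> (g i \<ominus> g i')" "g k \<ominus> g k' = b' \<otimes> (g i \<ominus> g i')"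
      using shear_eq[of a b] shear_eq[of a' b'] cd(3) ab' carr by (auto simp: c d G_def shear_eq_iff)
    then have diff0: "g i \<ominus> g i' = \<zero>"
      using ab(3) ab' carr by (metis m_rcancel minus_closed)
    have "g j \<ominus> g j' = \<zero>" "g k \<ominus> g k' = \<zero>"
      using eqs ab' unfolding diff0 by simp_all
    then have "g i = g i'" "g j = g j'" "g k = g k'"
      using diff0 carr by simp_all
    then have "G c = G d"
      by (simp add: c d G_def)
    then show "c = d"
      using G_inj cd(1,2) by (auto dest: inj_onD)
  qed

  have f_mem: "f m \<in> A" if "m < card A" for m
    using f that by (auto simp: bij_betw_def)
  show ?thesis
    unfolding exists_family_of_size_def mutually_orthogonal_sudoku_family_def pairwise_def
  proof (intro exI conjI ballI impI)
    show "block_partition (card (carrier R)) (card U1, card U2, card U3) (P U1, P U2, P U3)"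
      using part by (simp add: n_def)
    show "sudoku_hypercube (card (carrier R)) (card U1, card U2, card U3) (P U1, P U2, P U3)
        {0..<n^2} (L (fst (f m)) (snd (f m)))" if "m \<in> {..<card A}" for m
      using sudoku f_mem that by (simp add: n_def)
    show "orthogonal_hypercubes (card (carrier R)) (L (fst (f l)) (snd (f l))) (L (fst (f m)) (snd (f m)))"
      if "l \<in> {..<card A}" "m \<in> {..<card A}" "l \<noteq> m" for l m
    proof -
      have "f l \<noteq> f m"
        using f that by (auto simp: bij_betw_def dest: inj_onD)
      then show ?thesis
        using orth[of "fst (f l)" "snd (f l)" "fst (f m)" "snd (f m)"] f_mem that by (simp add: n_def)
    qed
  qed
qed

end

section \<open>Families over a cubic extension\<close>

text \<open>If \<open>k a + v = k' a + v'\<close> with \<open>k \<noteq> k'\<close>, then dividing by \<open>k - k'\<close> places \<open>a\<close> in \<open>V\<close>; hence the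
  representation of an element as \<open>k a + v\<close> is unique.\<close>

lemma (in field) card_line_extension:
  assumes K: "subfield K R" and V: "subgroup V (add_monoid R)"
    and smult: "\<And>k v. k \<in> K \<Longrightarrow> v \<in> V \<Longrightarrow> k \<otimes> v \<in> V"
    and a: "a \<in> carrier R" "a \<notin> V"
  shows "card (line_extension K a V) = card K * card V"
proof -
  have K_sub: "K \<subseteq> carrier R" and V_sub: "V \<subseteq> carrier R"
    using subfieldE(3)[OF K] subgroup.subset[OF V] by auto
  have V_minus: "v' \<ominus> v \<in> V" if "v \<in> V" "v' \<in> V" for v v'
    using that V unfolding a_minus_def a_inv_def
    by (metis subgroup.m_closed subgroup.m_inv_closed monoid.simps(1) monoid_record_simps(1))
  have K_minus: "k \<ominus> k' \<in> K" if "k \<in> K" "k' \<in> K" for k k'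
    using that subringE(5,7)[OF subfieldE(1)[OF K]] by (simp add: a_minus_def)
  have "inj_on (\<lambda>(k, v). k \<otimes> a \<oplus> v) (K \<times> V)"
  proof (rule inj_onI, clarify)
    fix k v k' v'
    assume kv: "k \<in> K" "v \<in> V" "k' \<in> K" "v' \<in> V" and eq: "k \<otimes> a \<oplus> v = k' \<otimes> a \<oplus> v'"
    have carr: "k \<in> carrier R" "v \<in> carrier R" "k' \<in> carrier R" "v' \<in> carrier R"
      using kv K_sub V_sub by auto
    have "(k \<ominus> k') \<otimes> a = (k \<otimes> a \<oplus> v) \<ominus> (k' \<otimes> a \<oplus> v') \<oplus> (v' \<ominus> v)"
      using carr a(1) by algebra
    also have "\<dots> = v' \<ominus> v"
      unfolding eq using carr a(1) by (simp add: a_minus_def r_neg)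
    finally have diff: "(k \<ominus> k') \<otimes> a = v' \<ominus> v" .
    have "k = k'"
    proof (rule ccontr)
      assume "k \<noteq> k'"
      then have nz: "k \<ominus> k' \<in> K - {\<zero>}"
        using carr K_minus kv by simp
      have "inv (k \<ominus> k') \<otimes> ((k \<ominus> k') \<otimes> a) \<in> V"
        unfolding diff using subfield_m_inv(1)[OF K nz] V_minus kv by (intro smult) auto
      also have "inv (k \<ominus> k') \<otimes> ((k \<ominus> k') \<otimes> a) = a"
        using subfield_m_inv[OF K nz] nz K_sub a(1) by (simp add: m_assoc[symmetric] subset_iff)
      finally show False
        using a(2) by contradiction
    qed
    moreover from this have "v = v'"
      using eq carr a(1) by simp
    ultimately show "k = k' \<and> v = v'" by simp
  qed
  moreover have "line_extension K a V = (\<lambda>(k, v). k \<otimes> a \<oplus> v) ` (K \<times> V)"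
    by (force simp: line_extension_mem_iff)
  ultimately show ?thesis
    by (simp add: card_image card_cartesian_product)
qed

context field
begin

text \<open>From here on the field is a three-dimensional vector space over its subfield \<open>K\<close>. A plane is a
  subspace \<open>line_extension K a K\<close>, spanned by \<open>1\<close> and an element \<open>a\<close> outside \<open>K\<close>.\<close>

context
  fixes K :: "'a set" and q :: nat
  assumes K: "subfield K R" and card_K: "card K = q" and card_R: "card (carrier R) = q ^ 3" and q: "q > 1"
begin

lemma finite_carrier: "finite (carrier R)"
  using card_R q by (metis card.infinite not_one_less_zero power_eq_0_iff zero_neq_one less_numeral_extra(3) gr_implies_not0)

lemma K_subgroup: "subgroup K (add_monoid R)"
  using subring.axioms(1)[OF subfieldE(1)[OF K]] .

lemma K_smult: "k \<in> K \<Longrightarrow> v \<in> K \<Longrightarrow> k \<otimes> v \<in> K"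
  using subringE(6)[OF subfieldE(1)[OF K]] .

lemma K_carrier: "K \<subseteq> carrier R"
  by (rule subfieldE(3)[OF K])

lemma plane:
  assumes "a \<in> carrier R" "a \<notin> K"
  shows plane_subgroup: "subgroup (line_extension K a K) (add_monoid R)"
    and plane_smult: "k \<in> K \<Longrightarrow> v \<in> line_extension K a K \<Longrightarrow> k \<otimes> v \<in> line_extension K a K"
    and plane_card: "card (line_extension K a K) = q ^ 2"
  using line_extension_is_subgroup[OF K K_subgroup assms(1)]
    line_extension_smult_closed[OF K K_smult K_carrier assms(1)]
    card_line_extension[OF K K_subgroup K_smult assms]
  by (auto simp: card_K power2_eq_square)

lemma space_eq_carrier:
  assumes "a \<in> carrier R" "a \<notin> K" "b \<in> carrier R" "b \<notin> line_extension K a K"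
  shows "line_extension K b (line_extension K a K) = carrier R"
proof (rule card_subset_eq[OF finite_carrier])
  have sub: "subgroup (line_extension K b (line_extension K a K)) (add_monoid R)"
    by (rule line_extension_is_subgroup[OF K plane_subgroup[OF assms(1,2)] assms(3)])
  then show "line_extension K b (line_extension K a K) \<subseteq> carrier R"
    using subgroup.subset by fastforce
  show "card (line_extension K b (line_extension K a K)) = card (carrier R)"
    using card_line_extension[OF K plane_subgroup[OF assms(1,2)] plane_smult[OF assms(1,2)] assms(3,4)]
    by (simp add: card_K card_R plane_card[OF assms(1,2)] power2_eq_square power3_eq_cube)
qed

lemma power_less: "q < q ^ 3" "q ^ 2 < q ^ 3"
  using q power_strict_increasing[of 1 3 q] power_strict_increasing[of 2 3 q] by auto

lemma obtain_plane:
  obtains U where "subgroup U (add_monoid R)" "\<And>k v. k \<in> K \<Longrightarrow> v \<in> U \<Longrightarrow> k \<otimes> v \<in> U" "card U = q ^ 2"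
proof -
  obtain t where "t \<in> carrier R" "t \<notin> K"
    using power_less(1) K_carrier card_K card_R by (metis less_irrefl subsetI subset_antisym)
  then show ?thesis
    using that[of "line_extension K t K"] plane by blast
qed

text \<open>All three groups are cosets of one plane \<open>U\<close>, and \<open>(a, b)\<close> ranges over the pairs for which \<open>1\<close>, \<open>a\<close>, \<open>b\<close>
  form a basis. A nonzero \<open>x\<close> with \<open>x\<close>, \<open>a x\<close>, \<open>b x\<close> in \<open>U\<close> would put every multiple of \<open>x\<close>, hence the
  whole field, into \<open>U\<close>.\<close>

lemma family_q2_q2_q2: "exists_family_of_size (q^3) (q^2, q^2, q^2) (q^2 * (q^2 - 1) * (q^2 - q))"
proof -
  obtain U where U: "subgroup U (add_monoid R)" "\<And>k v. k \<in> K \<Longrightarrow> v \<in> U \<Longrightarrow> k \<otimes> v \<in> U" "card U = q ^ 2"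
    using obtain_plane by blast
  have U_add: "u \<oplus> v \<in> U" if "u \<in> U" "v \<in> U" for u v
    using subgroup.m_closed[OF U(1) that] by simp
  have U_carrier: "U \<subseteq> carrier R"
    using subgroup.subset[OF U(1)] by simp
  define A where "A = (SIGMA a : carrier R - K. carrier R - line_extension K a K)"
  have "card A = (\<Sum>a\<in>carrier R - K. card (carrier R - line_extension K a K))"
    unfolding A_def using finite_carrier by (intro card_SigmaI) auto
  also have "\<dots> = (\<Sum>a\<in>carrier R - K. q ^ 3 - q ^ 2)"
  proof (rule sum.cong)
    fix a assume a: "a \<in> carrier R - K"
    then have "line_extension K a K \<subseteq> carrier R"
      using subgroup.subset[OF plane_subgroup[of a]] by simp
    then show "card (carrier R - line_extension K a K) = q ^ 3 - q ^ 2"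
      using a finite_carrier by (simp add: card_Diff_subset finite_subset plane_card card_R)
  qed simp
  also have "\<dots> = (q ^ 3 - q) * (q ^ 3 - q ^ 2)"
    using finite_carrier K_carrier by (simp add: card_Diff_subset finite_subset card_R card_K)
  also have "\<dots> = q ^ 2 * (q ^ 2 - 1) * (q ^ 2 - q)"
    by (simp add: power2_eq_square power3_eq_cube diff_mult_distrib2 mult_ac)
  finally have card_A: "card A = q ^ 2 * (q ^ 2 - 1) * (q ^ 2 - q)" .
  have "exists_family_of_size (card (carrier R)) (card U, card U, card U) (card A)"
  proof (rule exists_family_of_multiplications[OF finite_carrier U(1) U(1) U(1)])
    show "card U * card U * card U = (card (carrier R))\<^sup>2"
      by (simp add: U(3) card_R flip: power_mult power_add)
    have "\<zero> \<in> K"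
      using subringE(2)[OF subfieldE(1)[OF K]] .
    moreover have "\<zero> \<in> line_extension K a K" if "a \<in> carrier R - K" for a
      using subgroup.one_closed[OF plane_subgroup[of a]] that by simp
    ultimately show "A \<subseteq> (carrier R - {\<zero>}) \<times> (carrier R - {\<zero>})"
      unfolding A_def by auto
    fix a b x
    assume ab: "(a, b) \<in> A" and x: "x \<in> U" "a \<otimes> x \<in> U" "b \<otimes> x \<in> U"
    have ab': "a \<in> carrier R" "a \<notin> K" "b \<in> carrier R" "b \<notin> line_extension K a K"
      using ab by (auto simp: A_def)
    show "x = \<zero>"
    proof (rule ccontr)
      assume "x \<noteq> \<zero>"
      have "carrier R \<subseteq> U"
      proof
        fix y assume y: "y \<in> carrier R"
        have xR: "x \<in> carrier R" "x \<in> Units R"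
          using x U_carrier \<open>x \<noteq> \<zero>\<close> field_Units by auto
        define z where "z = y \<otimes> inv x"
        have "z \<in> line_extension K b (line_extension K a K)"
          using space_eq_carrier[OF ab'] xR y by (simp add: z_def)
        then obtain k l m where klm: "k \<in> K" "l \<in> K" "m \<in> K" "z = k \<otimes> b \<oplus> (l \<otimes> a \<oplus> m)"
          unfolding line_extension_mem_iff Bex_def by blast
        have klmR: "k \<in> carrier R" "l \<in> carrier R" "m \<in> carrier R"
          using klm K_carrier by auto
        have "y = z \<otimes> x"
          using xR y by (simp add: z_def m_assoc)
        also have "\<dots> = k \<otimes> (b \<otimes> x) \<oplus> (l \<otimes> (a \<otimes> x) \<oplus> m \<otimes> x)"
          unfolding klm(4) using klmR ab' xR(1) by algebra
        also have "\<dots> \<in> U"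
          by (rule U_add[OF U(2)[OF klm(1) x(3)] U_add[OF U(2)[OF klm(2) x(2)] U(2)[OF klm(3) x(1)]]])
        finally show "y \<in> U" .
      qed
      then have "q ^ 3 \<le> q ^ 2"
        using card_mono[of U "carrier R"] U_carrier finite_carrier card_R U(3) by (simp add: finite_subset)
      then show False
        using power_less by simp
    qed
  qed
  then show ?thesis
    by (simp add: card_R U(3) card_A)
qed

text \<open>With \<open>U\<close> a plane and \<open>K\<close> as second and third subgroup, the pairs are \<open>(c b, b)\<close> with \<open>c\<close> outside \<open>U\<close>.
  If \<open>b x = k\<close> is a nonzero element of \<open>K\<close>, then \<open>a x = c k\<close> lies in \<open>U\<close> only if \<open>c\<close> does.\<close>

lemma family_q3_q2_q: "exists_family_of_size (q^3) (q^3, q^2, q) (q^2 * (q - 1) * (q^3 - 1))"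
proof -
  obtain U where U: "subgroup U (add_monoid R)" "\<And>k v. k \<in> K \<Longrightarrow> v \<in> U \<Longrightarrow> k \<otimes> v \<in> U" "card U = q ^ 2"
    using obtain_plane by blast
  have U_carrier: "U \<subseteq> carrier R"
    using subgroup.subset[OF U(1)] by simp
  have zero_U: "\<zero> \<in> U"
    using subgroup.one_closed[OF U(1)] by simp
  define A where "A = (\<lambda>(c, b). (c \<otimes> b, b)) ` ((carrier R - U) \<times> (carrier R - {\<zero>}))"
  have "inj_on (\<lambda>(c, b). (c \<otimes> b, b)) ((carrier R - U) \<times> (carrier R - {\<zero>}))"
    by (auto intro!: inj_onI simp: m_rcancel)
  then have "card A = card (carrier R - U) * card (carrier R - {\<zero>})"
    unfolding A_def by (simp add: card_image card_cartesian_product)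
  also have "\<dots> = (q ^ 3 - q ^ 2) * (q ^ 3 - 1)"
    using finite_carrier U_carrier by (simp add: card_Diff_subset finite_subset card_R U(3))
  also have "q ^ 3 - q ^ 2 = q ^ 2 * (q - 1)"
    by (simp add: power2_eq_square power3_eq_cube diff_mult_distrib2)
  finally have card_A: "card A = q ^ 2 * (q - 1) * (q ^ 3 - 1)" .
  have "exists_family_of_size (card (carrier R)) (card (carrier R), card U, card K) (card A)"
  proof (rule exists_family_of_multiplications[OF finite_carrier _ U(1) K_subgroup])
    show "subgroup (carrier R) (add_monoid R)"
      using add.group_incl_imp_subgroup[of "carrier R"] add.subgroup_self by simp
    show "card (carrier R) * card U * card K = (card (carrier R))\<^sup>2"
      by (simp add: U(3) card_R card_K power2_eq_square power3_eq_cube)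
    show "A \<subseteq> (carrier R - {\<zero>}) \<times> (carrier R - {\<zero>})"
      using zero_U unfolding A_def by (auto simp: integral_iff)
    fix a b x
    assume ab: "(a, b) \<in> A" and x: "x \<in> carrier R" "a \<otimes> x \<in> U" "b \<otimes> x \<in> K"
    obtain c where c: "c \<in> carrier R" "c \<notin> U" "a = c \<otimes> b" and b: "b \<in> carrier R" "b \<noteq> \<zero>"
      using ab by (auto simp: A_def)
    show "x = \<zero>"
    proof (rule ccontr)
      assume "x \<noteq> \<zero>"
      define k where "k = b \<otimes> x"
      have k: "k \<in> K - {\<zero>}" "k \<in> carrier R"
        using x b \<open>x \<noteq> \<zero>\<close> by (auto simp: k_def integral_iff)
      have "c \<otimes> k \<in> U"
        using x(1,2) b c by (simp add: k_def m_assoc)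
      then have "inv k \<otimes> (c \<otimes> k) \<in> U"
        by (rule U(2)[rotated]) (use subfield_m_inv(1)[OF K k(1)] in simp)
      also have "inv k \<otimes> (c \<otimes> k) = c \<otimes> (k \<otimes> inv k)"
        using subfield_m_inv(1)[OF K k(1)] k(2) c(1) K_carrier by (simp add: m_ac subset_iff)
      also have "\<dots> = c"
        using subfield_m_inv(2)[OF K k(1)] c(1) by simp
      finally show False
        using c(2) by contradiction
    qed
  qed
  then show ?thesis
    by (simp add: card_R card_K U(3) card_A)
qed

text \<open>With third subgroup \<open>{0}\<close> the block condition reads \<open>b x = 0\<close>, which forces \<open>x = 0\<close> for every
  nonzero \<open>b\<close>.\<close>

lemma family_q3_q3_1: "exists_family_of_size (q^3) (q^3, q^3, 1) ((q^3 - 1)^2)"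
proof -
  let ?A = "(carrier R - {\<zero>}) \<times> (carrier R - {\<zero>})"
  have sub: "subgroup (carrier R) (add_monoid R)"
    using add.subgroup_self by simp
  have "exists_family_of_size (card (carrier R)) (card (carrier R), card (carrier R), card {\<zero>}) (card ?A)"
  proof (rule exists_family_of_multiplications[OF finite_carrier sub sub])
    show "subgroup {\<zero>} (add_monoid R)"
      using add.triv_subgroup by simp
  qed (auto simp: integral_iff power2_eq_square)
  moreover have "card ?A = (q ^ 3 - 1)^2"
    using finite_carrier by (simp add: card_cartesian_product power2_eq_square card_R)
  ultimately show ?thesis
    by (simp add: card_R)
qed

end

end

section \<open>Existence and optimality\<close>

theorem theorem4p3:
  fixes q :: nat
  assumes "primepow q"
  shows
    "exists_family_of_size (q^3) (q^2, q^2, q^2) (q^2 * (q^2 - 1) * (q^2 - q)) \<and>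
     exists_family_of_size (q^3) (q^3, q^2, q) (q^2 * (q - 1) * (q^3 - 1)) \<and>
     exists_family_of_size (q^3) (q^3, q^3, 1) ((q^3 - 1)^2) \<and>
     (\<forall>P (I :: 'i set) (S :: 'i \<Rightarrow> 's set) L.
       block_partition (q^3) (q^3, q^2, q) P \<and>
       mutually_orthogonal_sudoku_family (q^3) (q^3, q^2, q) P I S L \<longrightarrow>
       finite I \<and> card I \<le> q^2 * (q - 1) * (q^3 - 1)) \<and>
     (\<forall>P (I :: 'i set) (S :: 'i \<Rightarrow> 's set) L.
       block_partition (q^3) (q^3, q^3, 1) P \<and>
       mutually_orthogonal_sudoku_family (q^3) (q^3, q^3, 1) P I S L \<longrightarrow>
       finite I \<and> card I \<le> (q^3 - 1)^2)"
proof -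
  have q: "q > 1"
    using primepow_gt_Suc_0[OF assms] by simp
  obtain R :: "((int list \<times> nat) multiset \<Rightarrow> int) ring" and K
    where R: "field R" and K: "subfield K R" "card K = q" "card (carrier R) = q ^ 3"
    using exists_finite_field_extension[OF assms, of 3] by auto
  have "2 \<le> q ^ 3"
    using q power_increasing[of 1 3 q] by simp
  show ?thesis
  proof (intro conjI[OF field.family_q2_q2_q2[OF R K q]] conjI[OF field.family_q3_q2_q[OF R K q]]
      conjI[OF field.family_q3_q3_1[OF R K q]] conjI allI impI; elim conjE)
    fix P and I :: "'i set" and S :: "'i \<Rightarrow> 's set" and L
    assume P: "block_partition (q^3) (q^3, q^2, q) P"
      "mutually_orthogonal_sudoku_family (q^3) (q^3, q^2, q) P I S L"
    have "finite I \<and> card I \<le> q^2 * (q - 1) * (q^3 - 1)"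
      using block_q3_q2_q_family_card_le[OF _ P] q by simp
    then show "finite I" "card I \<le> q^2 * (q - 1) * (q^3 - 1)" by auto
  next
    fix P and I :: "'i set" and S :: "'i \<Rightarrow> 's set" and L
    assume "mutually_orthogonal_sudoku_family (q^3) (q^3, q^3, 1) P I S L"
    then have "finite I \<and> card I \<le> (q^3 - 1)^2"
      unfolding mutually_orthogonal_sudoku_family_def sudoku_hypercube_def
      by (intro latin_family_card_le[OF \<open>2 \<le> q ^ 3\<close>]) auto
    then show "finite I" "card I \<le> (q^3 - 1)^2" by auto
  qed
qed

end
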